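(* Let $n\ge 3$ and $k\ge 3$. There exists a cyclic sequence over $\{0,\dots,k-1\}$ of length $L_k(n)=|\mathbf{S}_k(n)|$ whose length-$n$ windows are exactly the elements of $\mathbf{S}_k(n)$, each occurring exactly once (a universal cycle for $\mathbf{S}_k(n)$); this sequence is an orientable sequence of order $n$.
   Context: Let $\Sigma=\{0,1,\dots,k-1\}$. Strings are compared lexicographically ($\alpha<\beta$ if $\alpha$ is a proper prefix of $\beta$, or $\alpha$ has the smaller symbol at the first index where they differ). For $\alpha=a_1\cdots a_n$, $\alpha^R=a_n\cdots a_1$; $[\alpha]$ is the set of rotations of $\alpha$. $\alpha$ is a necklace if it is the lexicographically smallest element of $[\alpha]$; a bracelet if it is the lexicographically smallest element of $[\alpha]\cup[\alpha^R]$. A necklace $\alpha$ is symmetric if $\alpha^R\in[\alpha]$, asymmetric otherwise. $\mathbf{A}_k(n)$ is the set of asymmetric bracelets of length $n$ over $\Sigma$, and $\mathbf{S}_k(n)=\bigcup_{\alpha\in\mathbf{A}_k(n)}[\alpha]$. A cyclic sequence $s_1\cdots s_L$ has windows $w_t=s_t\cdots s_{t+n-1}$ ($t=1,\dots,L$, indices mod $L$); it is an orientable sequence of order $n$ if the $2L$ strings $w_1,\dots,w_L,w_1^R,\dots,w_L^R$ are pairwise distinct. *)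

theory Defs
  imports Main
begin

definition lex_less :: "nat list \<Rightarrow> nat list \<Rightarrow> bool" where
  "lex_less \<alpha> \<beta> \<longleftrightarrow> (\<alpha>, \<beta>) \<in> lexord {(a, b). a < b}"

definition lex_le :: "nat list \<Rightarrow> nat list \<Rightarrow> bool" where
  "lex_le \<alpha> \<beta> \<longleftrightarrow> \<alpha> = \<beta> \<or> lex_less \<alpha> \<beta>"

definition rotations :: "nat list \<Rightarrow> nat list set" where
  "rotations \<alpha> = {rotate m \<alpha> | m. m < length \<alpha>} \<union> {\<alpha>}"

definition is_necklace :: "nat list \<Rightarrow> bool" where
  "is_necklace \<alpha> \<longleftrightarrow> (\<forall>\<beta>\<in>rotations \<alpha>. lex_le \<alpha> \<beta>)"

definition is_bracelet :: "nat list \<Rightarrow> bool" where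
  "is_bracelet \<alpha> \<longleftrightarrow> (\<forall>\<beta>\<in>rotations \<alpha> \<union> rotations (rev \<alpha>). lex_le \<alpha> \<beta>)"

definition symmetric_necklace :: "nat list \<Rightarrow> bool" where
  "symmetric_necklace \<alpha> \<longleftrightarrow> is_necklace \<alpha> \<and> rev \<alpha> \<in> rotations \<alpha>"

definition asymmetric_necklace :: "nat list \<Rightarrow> bool" where
  "asymmetric_necklace \<alpha> \<longleftrightarrow> is_necklace \<alpha> \<and> rev \<alpha> \<notin> rotations \<alpha>"

definition asym_bracelets :: "nat \<Rightarrow> nat \<Rightarrow> nat list set" where
  "asym_bracelets k n = {\<alpha>. length \<alpha> = n \<and> set \<alpha> \<subseteq> {..<k} \<and> is_bracelet \<alpha> \<and> asymmetric_necklace \<alpha>}"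

definition S_set :: "nat \<Rightarrow> nat \<Rightarrow> nat list set" where
  "S_set k n = (\<Union>\<alpha>\<in>asym_bracelets k n. rotations \<alpha>)"

definition window :: "nat list \<Rightarrow> nat \<Rightarrow> nat \<Rightarrow> nat list" where
  "window s n t = map (\<lambda>i. s ! ((t + i) mod length s)) [0..<n]"

definition orientable :: "nat \<Rightarrow> nat list \<Rightarrow> bool" where
  "orientable n s \<longleftrightarrow>
     inj_on (window s n) {..<length s} \<and>
     inj_on (\<lambda>t. rev (window s n t)) {..<length s} \<and>
     (\<forall>t<length s. \<forall>t'<length s. window s n t \<noteq> rev (window s n t'))"

end

theory Submission
  imports Defs "Graph_Theory.Euler"
begin

text \<open>
  The words of \<open>S_set k n\<close> are the arcs of a digraph on words of length \<open>n - 1\<close>, an arc \<open>w\<close> leading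
  from \<open>butlast w\<close> to \<open>tl w\<close>. Closure under rotation makes the digraph balanced, so a universal cycle
  is an Euler circuit, and only connectivity is at stake: any two asymmetric bracelets have to be
  linked by rotations and changes of single letters that stay inside \<open>S_set k n\<close>.

  Let \<open>M = k - 1\<close>. A bracelet without \<open>0\<close> stays an asymmetric bracelet if its first letter becomes
  \<open>0\<close>. In a bracelet beginning with \<open>0\<close>, raise the last letter below \<open>M\<close> by one. This yields an
  asymmetric bracelet unless the word is \<open>P M\<^sup>g (M - 1) M\<^sup>t\<close> with \<open>P\<close> a palindrome and \<open>g < t\<close>; in that
  case the last letter of \<open>P\<close> can be raised from \<open>0\<close> to \<open>1\<close> instead, unless \<open>P = 0\<close>. As the letter sum
  increases, every bracelet is linked to some \<open>0 M\<^sup>g (M - 1) M\<^sup>t\<close>, and these are linked to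
  \<open>0 (M - 1) M\<^bsup>n-2\<^esup>\<close> through words with a single \<open>0\<close>.
\<close>

section \<open>Universal cycles from Euler circuits\<close>

text \<open>Read on arcs: a rotation of \<open>w\<close> leaves the vertex that \<open>w\<close>
  enters, and words with the same \<open>tl\<close> enter a common vertex. Linked nonempty words are
  therefore arcs of one component.\<close>

definition word_link :: "'a list set \<Rightarrow> ('a list \<times> 'a list) set" where
  "word_link S = {(u, v). u \<in> S \<and> v \<in> S \<and> (u = rotate1 v \<or> v = rotate1 u \<or> tl u = tl v)}"

definition word_graph :: "'a list set \<Rightarrow> ('a list, 'a list) pre_digraph" where
  "word_graph S = \<lparr>verts = butlast ` S, arcs = S, tail = butlast, head = tl\<rparr>"

lemma butlast_rotate1: "w \<noteq> [] \<Longrightarrow> butlast (rotate1 w) = tl w"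
  by (cases w) auto

text \<open>As \<open>butlast (rotate1 w) = tl w\<close>, rotation carries arcs entering
  \<open>v\<close> to arcs leaving \<open>v\<close>. It is injective, hence onto on a finite closed
  set.\<close>

lemma word_graph_balanced:
  assumes "finite S" "[] \<notin> S" "\<And>w. w \<in> S \<Longrightarrow> rotate1 w \<in> S"
  shows "in_degree (word_graph S) v = out_degree (word_graph S) v"
proof -
  have surj: "rotate1 ` S = S"
    by (rule endo_inj_surj) (use assms in \<open>auto intro: inj_on_subset[OF inj_rotate1]\<close>)
  have "bij_betw rotate1 {w \<in> S. tl w = v} {w \<in> S. butlast w = v}"
    unfolding bij_betw_def
  proof
    show "inj_on rotate1 {w \<in> S. tl w = v}"
      by (rule inj_on_subset[OF inj_rotate1]) auto
    have "butlast (rotate1 w) = tl w" if "w \<in> S" for w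
      using that assms(2) by (intro butlast_rotate1) auto
    then show "rotate1 ` {w \<in> S. tl w = v} = {w \<in> S. butlast w = v}"
      by (subst (2) surj[symmetric]) auto
  qed
  then show ?thesis
    by (simp add: in_degree_def out_degree_def in_arcs_def out_arcs_def word_graph_def
        bij_betw_same_card)
qed

lemma word_graph_connected:
  assumes "S \<noteq> {}" "[] \<notin> S" "\<And>w. w \<in> S \<Longrightarrow> rotate1 w \<in> S"
    and "\<And>u v. u \<in> S \<Longrightarrow> v \<in> S \<Longrightarrow> (u, v) \<in> (word_link S)\<^sup>*"
  shows "connected (word_graph S)"
proof -
  let ?G = "word_graph S"
  let ?Q = "rtrancl_on (verts ?G) ((arcs_ends ?G)\<^sup>s)"
  have tl_bl: "tl w = butlast (rotate1 w)" if "w \<in> S" for w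
    using that assms(2) by (cases w) auto
  have verts: "butlast w \<in> verts ?G" "tl w \<in> verts ?G" if "w \<in> S" for w
    using that tl_bl[OF that] assms(3)[OF that] by (auto simp: word_graph_def)
  have fwd: "(butlast w, tl w) \<in> ?Q" and bwd: "(tl w, butlast w) \<in> ?Q" if "w \<in> S" for w
  proof -
    have "(butlast w, tl w) \<in> arcs_ends ?G"
      using that by (auto simp: arcs_ends_def arc_to_ends_def word_graph_def)
    then have "(butlast w, tl w) \<in> (arcs_ends ?G)\<^sup>s" "(tl w, butlast w) \<in> (arcs_ends ?G)\<^sup>s"
      by (auto simp: symcl_def)
    then show "(butlast w, tl w) \<in> ?Q" "(tl w, butlast w) \<in> ?Q"
      using verts[OF that] by (auto intro: rtrancl_on_into_rtrancl_on)
  qed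
  \<comment> \<open>Every vertex is the tail of some arc, so it suffices to follow chains of linked
    words through their tails.\<close>
  have "(butlast u, butlast v) \<in> ?Q" if "(u, v) \<in> (word_link S)\<^sup>*" "u \<in> S" for u v
    using that
  proof (induction rule: rtrancl_induct)
    case base
    then show ?case using verts by simp
  next
    case (step v w)
    then have S: "v \<in> S" "w \<in> S" and
      c: "v = rotate1 w \<or> w = rotate1 v \<or> tl v = tl w" by (auto simp: word_link_def)
    from c have "(butlast v, butlast w) \<in> ?Q"
    proof (elim disjE)
      assume "v = rotate1 w"
      then show ?thesis using bwd[OF S(2)] tl_bl[OF S(2)] by simp
    next
      assume "w = rotate1 v"
      then show ?thesis using fwd[OF S(1)] tl_bl[OF S(1)] by simp
    next
      assume "tl v = tl w"
      then show ?thesis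
        using fwd[OF S(1)] bwd[OF S(2)] by (metis rtrancl_on_trans)
    qed
    then show ?case using step by (metis rtrancl_on_trans)
  qed
  then show ?thesis
    using assms(1,4) unfolding connected_conv by (auto simp: word_graph_def)
qed

lemma (in pre_digraph) cas_nth_Suc:
  "cas u p v \<Longrightarrow> Suc i < length p \<Longrightarrow> head G (p ! i) = tail G (p ! Suc i)"
proof (induction p arbitrary: u i)
  case (Cons e p)
  show ?case
  proof (cases i)
    case 0
    then show ?thesis using Cons.prems by (cases p) auto
  next
    case (Suc j)
    then show ?thesis using Cons by auto
  qed
qed simp

lemma (in pre_digraph) cas_last: "cas u p v \<Longrightarrow> p \<noteq> [] \<Longrightarrow> head G (last p) = v"
  by (induction p arbitrary: u) auto

lemma (in pre_digraph) cas_hd: "cas u p v \<Longrightarrow> p \<noteq> [] \<Longrightarrow> tail G (p ! 0) = u"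
  by (cases p) auto

lemma universal_cycle_exists:
  assumes fin: "finite S" and ne: "S \<noteq> {}" and len: "\<And>w. w \<in> S \<Longrightarrow> length w = n" and "n > 0"
    and rot: "\<And>w. w \<in> S \<Longrightarrow> rotate1 w \<in> S"
    and con: "\<And>u v. u \<in> S \<Longrightarrow> v \<in> S \<Longrightarrow> (u, v) \<in> (word_link S)\<^sup>*"
  shows "\<exists>s. length s = card S \<and> set s \<subseteq> \<Union>(set ` S) \<and> bij_betw (window s n) {..<length s} S"
proof -
  let ?G = "word_graph S"
  have nil: "[] \<notin> S" using len \<open>n > 0\<close> by force
  have bl: "tl w = butlast (rotate1 w)" if "w \<in> S" for w
    using that nil by (cases w) auto
  interpret fin_digraph ?G
    by unfold_locales (use fin bl rot in \<open>auto simp: word_graph_def\<close>)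
  obtain u p where "euler_trail u p u"
    using closed_euler1[OF word_graph_connected[OF ne nil rot con] word_graph_balanced[OF fin nil rot]]
    by blast
  then have cas: "cas u p u" and dist: "distinct p" and "set p = arcs ?G"
    by (auto simp: euler_trail_def trail_def awalk_def)
  then have set: "set p = S" by (simp add: word_graph_def)
  let ?L = "length p"
  have L: "?L = card S" using dist set distinct_card by fastforce
  have "p \<noteq> []" using set ne by auto
  \<comment> \<open>The trail is closed, so the last arc also overlaps the first; hence the index
    modulo the length.\<close>
  have step: "tl (p ! m) = butlast (p ! (Suc m mod ?L))" if "m < ?L" for m
  proof (cases "Suc m = ?L")
    case True
    then have "p ! m = last p" by (metis \<open>p \<noteq> []\<close> diff_Suc_1 last_conv_nth)
    then show ?thesis
      using cas_last[OF cas \<open>p \<noteq> []\<close>] cas_hd[OF cas \<open>p \<noteq> []\<close>] True by (simp add: word_graph_def)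
  next
    case False
    then show ?thesis
      using cas_nth_Suc[OF cas, of m] that by (simp add: word_graph_def)
  qed
  have lenp: "length (p ! m) = n" if "m < ?L" for m
    using that set len by force
  \<comment> \<open>Overlaps accumulate: the arc \<open>i\<close> steps later is the old word
    shifted by \<open>i\<close>. With \<open>j = 0\<close>, the first letters of successive arcs
    spell out the arc at \<open>t\<close>.\<close>
  have shift: "p ! ((t + i) mod ?L) ! j = p ! t ! (i + j)" if "t < ?L" "i + j < n" for t i j
    using that
  proof (induction i arbitrary: j)
    case (Suc i)
    let ?m = "(t + i) mod ?L"
    have m: "?m < ?L" using \<open>p \<noteq> []\<close> by simp
    have "p ! ((t + Suc i) mod ?L) ! j = butlast (p ! (Suc ?m mod ?L)) ! j"
      using Suc.prems lenp[of "(t + Suc i) mod ?L"] \<open>p \<noteq> []\<close> by (simp add: mod_Suc_eq nth_butlast)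
    also have "\<dots> = tl (p ! ?m) ! j" using step[OF m] by simp
    also have "\<dots> = p ! ?m ! Suc j" using Suc.prems lenp[OF m] by (simp add: nth_tl)
    also have "\<dots> = p ! t ! (i + Suc j)" using Suc by auto
    finally show ?case by simp
  qed simp
  define s where "s = map hd p"
  have win: "window s n t = p ! t" if "t < ?L" for t
  proof (rule nth_equalityI)
    show "length (window s n t) = length (p ! t)" using lenp[OF that] by (simp add: window_def)
    fix i assume "i < length (window s n t)"
    then have i: "i < n" by (simp add: window_def)
    let ?m = "(t + i) mod ?L"
    have m: "?m < ?L" using \<open>p \<noteq> []\<close> by simp
    then have "p ! ?m \<noteq> []" using lenp \<open>n > 0\<close> by fastforce
    then show "window s n t ! i = p ! t ! i"
      using i m shift[OF that, of i 0] by (simp add: window_def s_def hd_conv_nth)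
  qed
  have "bij_betw (window s n) {..<length s} S"
    using bij_betw_nth[OF dist refl set[symmetric]] win
    by (subst bij_betw_cong[where g = "(!) p"]) (auto simp: s_def)
  moreover have "set s \<subseteq> \<Union>(set ` S)"
    using set nil unfolding s_def by (auto intro!: bexI hd_in_set)
  ultimately show ?thesis using L by (intro exI[of _ s]) (simp add: s_def)
qed

section \<open>Asymmetric bracelets\<close>

lemma lex_less_Nil [simp]: "\<not> lex_less x []"
  by (simp add: lex_less_def)

lemma lex_less_Cons_Cons [simp]:
  "lex_less (a # x) (b # y) \<longleftrightarrow> a < b \<or> a = b \<and> lex_less x y"
  by (auto simp: lex_less_def)

lemma lex_less_append_iff:
  "length x = length x' \<Longrightarrow>
    lex_less (x @ y) (x' @ y') \<longleftrightarrow> lex_less x x' \<or> x = x' \<and> lex_less y y'"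
  by (induction x x' rule: list_induct2) auto

lemma lex_less_irrefl [simp]: "\<not> lex_less x x"
  by (induction x) auto

lemma lex_less_trans: "lex_less x y \<Longrightarrow> lex_less y z \<Longrightarrow> lex_less x z"
  unfolding lex_less_def by (rule lexord_trans) (auto simp: trans_def)

lemma lex_less_imp_not_le: "lex_less x y \<Longrightarrow> \<not> lex_le y x"
  unfolding lex_le_def using lex_less_trans lex_less_irrefl by blast

lemma lex_less_iff_nth:
  "length x = length y \<Longrightarrow>
    lex_less x y \<longleftrightarrow> (\<exists>d < length x. (\<forall>i<d. x ! i = y ! i) \<and> x ! d < y ! d)"
proof (induction x y rule: list_induct2)
  case (Cons a x b y)
  then show ?case by (simp add: Ex_less_Suc2 All_less_Suc2 del: length_Suc_conv) auto
qed simp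

text \<open>The comparison is settled at \<open>r\<close> or before, where the change of
  \<open>f\<close> at \<open>q\<close> is not yet seen: \<open>e\<close> is the first difference of
  \<open>f\<close> and \<open>g\<close>, or \<open>r\<close> if that comes no later.\<close>

lemma lex_le_raise:
  assumes len: "length f = length g" and le: "lex_le f g" and "r < q" "q < length f" "g ! r < d"
  shows "lex_less (f[q := c]) (g[r := d])"
proof -
  obtain e where e: "e < length f" "e \<le> r" "\<forall>i<e. f ! i = g ! i" "e < r \<Longrightarrow> f ! e < g ! e"
    "f ! e \<le> g ! e"
  proof (cases "f = g")
    case True
    then show ?thesis using assms by (intro that[of r]) auto
  next
    case False
    then obtain d where d: "d < length f" "\<forall>i<d. f ! i = g ! i" "f ! d < g ! d"
      using le len by (auto simp: lex_le_def lex_less_iff_nth)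
    show ?thesis
    proof (cases "d < r")
      case True
      then show ?thesis using d by (intro that[of d]) auto
    next
      case False
      moreover from this have "f ! r \<le> g ! r" using d by (cases "d = r") auto
      ultimately show ?thesis using d assms by (intro that[of r]) auto
    qed
  qed
  then show ?thesis
    using assms by (subst lex_less_iff_nth) (auto intro!: exI[of _ e] simp: nth_list_update)
qed

text \<open>The bound on \<open>length b\<close> puts \<open>q\<close> in the middle or to its
  right, so the raised letter appears in the reversal at a place \<open>r\<close> with
  \<open>r \<le> q\<close>. If \<open>r = q\<close>, both words change alike and the old first
  difference remains.\<close>

lemma lex_less_rev_raise:
  assumes "lex_less b (rev b)" "q < length b" "length b \<le> 2 * q + 1" "b ! q < c"
  shows "lex_less (b[q := c]) (rev (b[q := c]))"
proof -
  define r where "r = length b - q - 1"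
  have rev: "rev (b[q := c]) = (rev b)[r := c]"
    using assms by (simp add: rev_update r_def)
  have br: "rev b ! r = b ! q" using assms by (simp add: rev_nth r_def)
  show ?thesis
  proof (cases "r < q")
    case True
    then show ?thesis
      unfolding rev using assms br by (intro lex_le_raise) (auto simp: lex_le_def)
  next
    case False
    then have [simp]: "r = q" using assms unfolding r_def by simp
    obtain d where d: "d < length b" "\<forall>i<d. b ! i = rev b ! i" "b ! d < rev b ! d"
      using assms by (auto simp: lex_less_iff_nth)
    then have "d \<noteq> q" using br by auto
    then show ?thesis
      unfolding rev using d assms
      by (subst lex_less_iff_nth) (auto intro!: exI[of _ d] simp: nth_list_update)
  qed
qed

text \<open>Strictness against the backward rotations combines minimality with asymmetry. All
  \<open>m\<close> are allowed because rotation is periodic.\<close>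

definition asym_bracelet :: "nat list \<Rightarrow> bool" where
  "asym_bracelet a \<longleftrightarrow> (\<forall>m. lex_le a (rotate m a)) \<and> (\<forall>m. lex_less a (rotate m (rev a)))"

lemma rotations_eq: "rotations a = range (\<lambda>m. rotate m a)"
proof (cases "a = []")
  case True
  then show ?thesis by (auto simp: rotations_def)
next
  case False
  show ?thesis
  proof
    show "rotations a \<subseteq> range (\<lambda>m. rotate m a)"
      unfolding rotations_def by (auto intro: range_eqI[of _ _ 0])
    show "range (\<lambda>m. rotate m a) \<subseteq> rotations a"
    proof clarify
      fix m
      have "rotate m a = rotate (m mod length a) a" "m mod length a < length a"
        using False by (auto intro: rotate_conv_mod)
      then show "rotate m a \<in> rotations a" unfolding rotations_def by blast
    qed
  qed
qed

lemma rotate_eq_imp: "rotate m a = b \<Longrightarrow> \<exists>m'. rotate m' b = a"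
proof (cases "a = []")
  case False
  assume b: "rotate m a = b"
  have "rotate (length a - m mod length a) b = rotate (length a) a"
    using False unfolding b[symmetric]
    by (subst (2) rotate_conv_mod) (simp add: rotate_rotate less_imp_le)
  then show ?thesis by auto
qed auto

lemma rev_rotate_ex: "\<exists>m'. rev (rotate m a) = rotate m' (rev a)"
proof -
  have "rotate m (rev (rev a)) = rev (rotate (length a - (m mod length a)) (rev a))"
    using rotate_rev[of m "rev a"] by simp
  then show ?thesis by (metis rev_rev_ident)
qed

lemma asym_bracelet_iff:
  "asym_bracelet a \<longleftrightarrow> is_bracelet a \<and> asymmetric_necklace a"
proof
  assume a: "asym_bracelet a"
  have "rev a \<notin> rotations a"
  proof
    assume "rev a \<in> rotations a"
    then obtain m where "rotate m (rev a) = a"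
      unfolding rotations_eq using rotate_eq_imp by fastforce
    then show False using a unfolding asym_bracelet_def by (metis lex_less_irrefl)
  qed
  then show "is_bracelet a \<and> asymmetric_necklace a"
    using a unfolding asym_bracelet_def is_bracelet_def asymmetric_necklace_def is_necklace_def
      rotations_eq lex_le_def by auto
next
  assume a: "is_bracelet a \<and> asymmetric_necklace a"
  have "a \<noteq> rotate m (rev a)" for m
  proof
    assume "a = rotate m (rev a)"
    then have "rev a \<in> rotations a" unfolding rotations_eq using rotate_eq_imp by (metis rangeI)
    then show False using a by (simp add: asymmetric_necklace_def)
  qed
  then show "asym_bracelet a"
    using a unfolding asym_bracelet_def is_bracelet_def rotations_eq lex_le_def by blast
qed

text \<open>Splitting at \<open>p\<close> makes each backward rotation a reversed prefix followed by
  the reversed rest, so that palindromic prefixes become visible. The case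
  \<open>p = length a\<close> is the plain reversal.\<close>

lemma asym_bracelet_iff_drop_take:
  assumes "a \<noteq> []"
  shows "asym_bracelet a \<longleftrightarrow>
    (\<forall>p. 0 < p \<and> p < length a \<longrightarrow> lex_le a (drop p a @ take p a)) \<and>
    (\<forall>p. 0 < p \<and> p \<le> length a \<longrightarrow> lex_less a (rev (take p a) @ rev (drop p a)))"
    (is "_ \<longleftrightarrow> ?F \<and> ?B")
proof -
  let ?n = "length a"
  have "(\<forall>m. lex_le a (rotate m a)) \<longleftrightarrow> (\<forall>p<?n. lex_le a (rotate p a))"
    using assms by (metis rotate_conv_mod length_greater_0_conv mod_less_divisor)
  also have "\<dots> \<longleftrightarrow> ?F"
    by (auto simp: rotate_drop_take) (metis lex_le_def append_Nil2 drop_0 gr0I take_0)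
  finally have 1: "(\<forall>m. lex_le a (rotate m a)) \<longleftrightarrow> ?F" .
  have eq: "rotate m (rev a) = rev (take (?n - m) a) @ rev (drop (?n - m) a)" if "m < ?n" for m
    using that by (simp add: rotate_drop_take drop_rev take_rev)
  have "(\<forall>m. lex_less a (rotate m (rev a))) \<longleftrightarrow> (\<forall>m<?n. lex_less a (rotate m (rev a)))"
    using assms by (metis rotate_conv_mod length_greater_0_conv mod_less_divisor length_rev)
  also have "\<dots> \<longleftrightarrow> (\<forall>m<?n. lex_less a (rev (take (?n - m) a) @ rev (drop (?n - m) a)))"
    using eq by simp
  also have "\<dots> \<longleftrightarrow> ?B"
  proof (intro iffI allI impI)
    fix p assume *: "\<forall>m<?n. lex_less a (rev (take (?n - m) a) @ rev (drop (?n - m) a))"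
      and p: "0 < p \<and> p \<le> ?n"
    then have "?n - p < ?n" "?n - (?n - p) = p" by auto
    then show "lex_less a (rev (take p a) @ rev (drop p a))" using * by metis
  next
    fix m assume "?B" "m < ?n"
    then show "lex_less a (rev (take (?n - m) a) @ rev (drop (?n - m) a))" by auto
  qed
  finally show ?thesis using 1 unfolding asym_bracelet_def by simp
qed

text \<open>Any proper rotation, and any backward rotation with \<open>p > 1\<close>, begins with a
  nonzero letter. Only \<open>p = 1\<close> remains, and it compares \<open>b\<close> with
  \<open>rev b\<close>.\<close>

lemma asym_bracelet_Cons_zero:
  assumes "0 \<notin> set b" "lex_less b (rev b)"
  shows "asym_bracelet (0 # b)"
  unfolding asym_bracelet_iff_drop_take[OF list.distinct(2)]
proof (intro conjI allI impI)
  fix p assume p: "0 < p \<and> p < length (0 # b)"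
  then obtain j where j: "p = Suc j" "j < length b" by (cases p) auto
  then have "drop p (0 # b) = b ! j # drop (Suc j) b" by (simp add: Cons_nth_drop_Suc)
  moreover have "b ! j \<noteq> 0" using j assms(1) by (metis nth_mem)
  ultimately show "lex_le (0 # b) (drop p (0 # b) @ take p (0 # b))" by (simp add: lex_le_def)
next
  fix p assume p: "0 < p \<and> p \<le> length (0 # b)"
  show "lex_less (0 # b) (rev (take p (0 # b)) @ rev (drop p (0 # b)))"
  proof (cases "p = 1")
    case True
    then show ?thesis using assms by simp
  next
    case False
    then have "\<exists>j. p = Suc (Suc j)" using p by presburger
    then obtain j where j: "p = Suc (Suc j)" by blast
    then have "j < length b" using p by simp
    then have "take p (0 # b) = 0 # take j b @ [b ! j]"
      using j by (simp add: take_Suc_conv_app_nth)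
    moreover have "b ! j \<noteq> 0" using \<open>j < length b\<close> assms(1) by (metis nth_mem)
    ultimately show ?thesis by simp
  qed
qed

text \<open>Raising one letter makes every forward rotation that starts before it larger at an earlier
  place than the word itself; a backward rotation is already decided inside the prefix it reverses,
  unless this prefix is a palindrome.\<close>

lemma asym_bracelet_raise:
  assumes a: "asym_bracelet a" and q: "0 < q" "q < length a" and c: "a ! q < c" "a ! 0 < c"
    and big: "\<And>i. q < i \<Longrightarrow> i < length a \<Longrightarrow> a ! 0 < a ! i"
    and pal: "\<And>p. 0 < p \<Longrightarrow> p \<le> q \<Longrightarrow> rev (take p a) = take p a \<Longrightarrow>
      lex_less (drop p a) (rev (drop p a)) \<Longrightarrow>
      lex_less (drop p (a[q := c])) (rev (drop p (a[q := c])))"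
  shows "asym_bracelet (a[q := c])"
proof -
  let ?a = "a[q := c]" and ?n = "length a"
  have ne: "a \<noteq> []" "?a \<noteq> []" using q by auto
  note A = a[unfolded asym_bracelet_iff_drop_take[OF ne(1)]]
  \<comment> \<open>Rotations in either direction that begin with a letter from \<open>q\<close>
    onwards are thus larger at once.\<close>
  have lt: "a ! 0 < ?a ! i" if "q \<le> i" "i < ?n" for i
    using that big c by (cases "i = q") auto
  have hd: "lex_less ?a y" if "length y = ?n" "a ! 0 < y ! 0" for y
    using that q by (subst lex_less_iff_nth) (auto intro!: exI[of _ 0])
  show ?thesis
    unfolding asym_bracelet_iff_drop_take[OF ne(2)]
  proof (intro conjI allI impI)
    fix p assume p: "0 < p \<and> p < length ?a"
    show "lex_le ?a (drop p ?a @ take p ?a)"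
    proof (cases "p < q")
      case True
      have "drop p ?a @ take p ?a = (drop p a @ take p a)[q - p := c]"
        using True q by (simp add: drop_update_swap list_update_append1)
      moreover have "lex_less ?a ((drop p a @ take p a)[q - p := c])"
        by (rule lex_le_raise) (use A True p q c in \<open>auto simp: nth_append\<close>)
      ultimately show ?thesis by (simp add: lex_le_def)
    next
      case False
      then have "lex_less ?a (drop p ?a @ take p ?a)"
        using p lt[of p] by (intro hd) (auto simp: nth_append)
      then show ?thesis by (simp add: lex_le_def)
    qed
  next
    fix p assume p: "0 < p \<and> p \<le> length ?a"
    show "lex_less ?a (rev (take p ?a) @ rev (drop p ?a))"
    proof (cases "p \<le> q")
      case True
      have tk: "take p ?a = take p a" using True by simp
      have "lex_less (take p a @ drop p a) (rev (take p a) @ rev (drop p a))"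
        using A p by simp
      then have "lex_less (take p a) (rev (take p a)) \<or>
        take p a = rev (take p a) \<and> lex_less (drop p a) (rev (drop p a))"
        by (subst (asm) lex_less_append_iff) auto
      then have "lex_less (take p ?a @ drop p ?a) (rev (take p ?a) @ rev (drop p ?a))"
        using pal[of p] p True by (subst lex_less_append_iff) (auto simp: tk)
      then show ?thesis by simp
    next
      case False
      then show ?thesis
        using p lt[of "p - 1"] by (intro hd) (auto simp: nth_append rev_nth)
    qed
  qed
qed


lemma lex_less_replicate_max:
  assumes "set x \<subseteq> {..M}" "x \<noteq> replicate (length x) M"
  shows "lex_less x (replicate (length x) M)"
  using assms by (induction x) (auto simp: le_less)

text \<open>After a palindromic prefix the rest is \<open>G c M^t\<close>. If
  \<open>t \<le> length G\<close>, then \<open>c\<close> is not left of the middle. Otherwise the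
  reversed rest starts with more than \<open>length G\<close> letters \<open>M\<close>, which is
  larger unless \<open>G\<close> consists of \<open>M\<close> and the raised letter is
  \<open>M\<close> too.\<close>

lemma asym_bracelet_raise_last:
  fixes M :: nat
  assumes a: "asym_bracelet (d @ c # replicate t M)" (is "asym_bracelet ?a")
    and d: "d \<noteq> []" "hd d = 0" "set d \<subseteq> {..M}" and "c < M"
  shows "asym_bracelet (d @ Suc c # replicate t M) \<or>
    (\<exists>P g. P \<noteq> [] \<and> rev P = P \<and> g < t \<and> d = P @ replicate g M \<and> Suc c = M)"
proof (rule disjCI)
  assume neg: "\<not> (\<exists>P g. P \<noteq> [] \<and> rev P = P \<and> g < t \<and> d = P @ replicate g M \<and> Suc c = M)"
  let ?q = "length d"
  have upd: "?a[?q := Suc c] = d @ Suc c # replicate t M" by simp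
  have a0: "?a ! 0 = 0" using d by (simp add: nth_append hd_conv_nth)
  have "asym_bracelet (?a[?q := Suc c])"
  proof (rule asym_bracelet_raise[OF a])
    fix p assume p: "0 < p" "p \<le> ?q" and pal: "rev (take p ?a) = take p ?a"
      and less: "lex_less (drop p ?a) (rev (drop p ?a))"
    let ?P = "take p d" and ?g = "drop p d"
    have dr: "drop p ?a = ?g @ c # replicate t M" using p by simp
    have dr'': "drop p (?a[?q := Suc c]) = ?g @ Suc c # replicate t M"
      unfolding upd using p by simp
    have dr': "drop p (?a[?q := Suc c]) = (drop p ?a)[length ?g := Suc c]"
      unfolding dr dr'' by (simp only: list_update_length)
    show "lex_less (drop p (?a[?q := Suc c])) (rev (drop p (?a[?q := Suc c])))"
    proof (cases "t \<le> length ?g")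
      case True
      show ?thesis
        unfolding dr' by (rule lex_less_rev_raise[OF less]) (use True p in \<open>auto simp: nth_append\<close>)
    next
      case False
      then have rep: "replicate t M = replicate (length ?g) M @ M # replicate (t - length ?g - 1) M"
        by (simp flip: replicate_Suc replicate_add add: Suc_diff_Suc)
      have "rev (?g @ Suc c # replicate t M) = replicate t M @ Suc c # rev ?g" by simp
      also have "\<dots> =
          replicate (length ?g) M @ M # replicate (t - length ?g - 1) M @ Suc c # rev ?g"
        unfolding rep by simp
      finally have rv: "rev (?g @ Suc c # replicate t M) =
          replicate (length ?g) M @ M # replicate (t - length ?g - 1) M @ Suc c # rev ?g" .
      show ?thesis
      proof (cases "?g = replicate (length ?g) M")
        case True
        have "?P \<noteq> []" "rev ?P = ?P" "d = ?P @ ?g" "length ?g < t" using p pal False d by auto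
        with True neg have "Suc c \<noteq> M" by metis
        then have "lex_less (Suc c # replicate t M) (M # replicate (t - length ?g - 1) M @ Suc c # rev ?g)"
          using \<open>c < M\<close> by simp
        then show ?thesis
          unfolding dr'' rv using True by (subst lex_less_append_iff) auto
      next
        case g: False
        have "set ?g \<subseteq> {..M}" using d(3) set_drop_subset by fastforce
        then show ?thesis
          unfolding dr'' rv using lex_less_replicate_max[OF _ g] by (subst lex_less_append_iff) auto
      qed
    qed
  qed (use a0 d \<open>c < M\<close> in \<open>auto simp: nth_append nth_Cons'\<close>)
  then show "asym_bracelet (d @ Suc c # replicate t M)" by simp
qed

text \<open>The only obstruction is \<open>M = 2\<close> with the palindrome ending in \<open>M\<^sup>t 0\<close>, hence beginning with
  \<open>0 M\<^sup>t\<close>. That is excluded by the rotation beginning with \<open>0 M\<^sup>g (M - 1)\<close>.\<close>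

lemma asym_bracelet_raise_palindrome:
  fixes M :: nat
  assumes a: "asym_bracelet (d @ 0 # replicate g M @ (M - 1) # replicate t M)" (is "asym_bracelet ?a")
    and d: "d \<noteq> []" "hd d = 0" "rev (d @ [0]) = d @ [0]" and "g < t" "M \<ge> 2"
  shows "asym_bracelet (d @ 1 # replicate g M @ (M - 1) # replicate t M)"
proof -
  let ?q = "length d"
  let ?r = "replicate g M @ (M - 1) # replicate t M"
  have upd: "?a[?q := 1] = d @ 1 # ?r" by simp
  have a0: "?a ! 0 = 0" using d by (simp add: nth_append hd_conv_nth)
  have "asym_bracelet (?a[?q := 1])"
  proof (rule asym_bracelet_raise[OF a])
    fix p assume p: "0 < p" "p \<le> ?q" and pal: "rev (take p ?a) = take p ?a"
      and less: "lex_less (drop p ?a) (rev (drop p ?a))"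
    let ?g = "drop p d"
    have dr: "drop p ?a = ?g @ 0 # ?r" using p by simp
    have dr'': "drop p (?a[?q := 1]) = ?g @ 1 # ?r"
      unfolding upd using p by simp
    have dr': "drop p (?a[?q := 1]) = (drop p ?a)[length ?g := 1]"
      unfolding dr dr'' by (simp only: list_update_length)
    show "lex_less (drop p (?a[?q := 1])) (rev (drop p (?a[?q := 1])))"
    proof (cases "g + t + 1 \<le> length ?g")
      case True
      show ?thesis
        unfolding dr' by (rule lex_less_rev_raise[OF less]) (use True p in \<open>auto simp: nth_append\<close>)
    next
      case False
      \<comment> \<open>\<open>W\<close> is the reversal of \<open>?r\<close>; \<open>w\<close> is
        the letter that meets the raised \<open>1\<close> in the comparison with the
        reversal.\<close>
      define W where "W = replicate t M @ (M - 1) # replicate g M"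
      have lW: "length ?g < length W" using False by (simp add: W_def)
      define W1 w W2 where "W1 = take (length ?g) W" and "w = W ! length ?g"
        and "W2 = drop (Suc (length ?g)) W"
      have W: "W = W1 @ w # W2" "length W1 = length ?g"
        using lW by (auto simp: W1_def w_def W2_def id_take_nth_drop)
      have "rev (?g @ e # ?r) = W @ e # rev ?g" for e by (simp add: W_def)
      then have rv: "rev (?g @ e # ?r) = W1 @ w # W2 @ e # rev ?g" for e
        unfolding W(1) by simp
      have w: "w = M \<or> w = M - 1"
        using lW by (auto simp: w_def W_def nth_append nth_Cons')
      have "lex_less (?g @ 0 # ?r) (W1 @ w # W2 @ 0 # rev ?g)"
        using less unfolding dr rv .
      then have cases: "lex_less ?g W1 \<or> ?g = W1"
        using W(2) by (subst (asm) lex_less_append_iff) auto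
      \<comment> \<open>If \<open>w = 1\<close>, then \<open>w\<close> is the only letter
        \<open>M - 1\<close> of \<open>W\<close>, at position \<open>t\<close>, so \<open>d\<close>
        ends in \<open>M^t\<close>.\<close>
      have "w \<noteq> 1" if "?g = W1"
      proof
        assume "w = 1"
        then have "w \<noteq> M" using \<open>M \<ge> 2\<close> by simp
        then have "length ?g = t"
          using lW by (auto simp: w_def W_def nth_append nth_Cons' split: if_splits)
        then have "W1 = take t W" by (simp only: W1_def)
        then have "W1 = replicate t M" by (simp add: W_def)
        then have dx: "d = take p d @ replicate t M" using that by (metis append_take_drop_id)
        have "rev ((take p d @ replicate t M) @ [0]) = 0 # replicate t M @ rev (take p d)" by simp
        then have "d @ [0] = 0 # replicate t M @ rev (take p d)" using d(3) dx by metis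
        moreover have "?a = (d @ [0]) @ ?r" by simp
        ultimately have "?a = (0 # replicate t M @ rev (take p d)) @ ?r" by metis
        moreover have "replicate t M = replicate g M @ M # replicate (t - g - 1) M"
          using \<open>g < t\<close> by (simp flip: replicate_Suc replicate_add add: Suc_diff_Suc)
        ultimately have a': "?a = (0 # replicate g M) @ M # replicate (t - g - 1) M @ rev (take p d) @ ?r"
          by simp
        let ?rot = "rotate ?q ?a"
        have rot: "?rot = (0 # replicate g M) @ (M - 1) # replicate t M @ d"
          by (simp add: rotate_append)
        \<comment> \<open>Position \<open>g + 1\<close> decides: \<open>M - 1\<close> in the
          rotation, but \<open>M\<close> in the word, because \<open>g < t\<close>.\<close>
        have "lex_less ?rot ?a"
          unfolding rot using \<open>M \<ge> 2\<close> by (subst a', subst lex_less_append_iff) auto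
        moreover have "lex_le ?a ?rot"
          using a unfolding asym_bracelet_def by blast
        ultimately show False using lex_less_imp_not_le by blast
      qed
      then have "?g = W1 \<Longrightarrow> 1 < w" using w \<open>M \<ge> 2\<close> by auto
      then have "lex_less (?g @ 1 # ?r) (W1 @ w # W2 @ 1 # rev ?g)"
        unfolding lex_less_append_iff[OF W(2)[symmetric]] lex_less_Cons_Cons using cases by blast
      then show ?thesis unfolding dr'' rv .
    qed
  qed (use a0 d \<open>M \<ge> 2\<close> in \<open>auto simp: nth_append nth_Cons'\<close>)
  then show ?thesis by simp
qed

section \<open>Connectivity\<close>

lemma S_set_iff:
  "w \<in> S_set k n \<longleftrightarrow>
    (\<exists>a m. asym_bracelet a \<and> length a = n \<and> set a \<subseteq> {..<k} \<and> w = rotate m a)"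
  unfolding S_set_def asym_bracelets_def rotations_eq asym_bracelet_iff by auto

lemma rotate_in_S_set: "w \<in> S_set k n \<Longrightarrow> rotate m w \<in> S_set k n"
  unfolding S_set_iff by (metis rotate_rotate)

lemma asym_bracelet_in_S_set:
  "asym_bracelet a \<Longrightarrow> length a = n \<Longrightarrow> set a \<subseteq> {..<k} \<Longrightarrow> a \<in> S_set k n"
  unfolding S_set_iff by (metis id_apply rotate0)

text \<open>This yields orientability: the bracelets of \<open>u\<close> and \<open>v\<close> would
  be backward rotations of each other, each strictly smaller than the other.\<close>

lemma rev_notin_S_set:
  assumes "u \<in> S_set k n" "v \<in> S_set k n"
  shows "u \<noteq> rev v"
proof
  assume "u = rev v"
  from assms obtain a b i j where a: "asym_bracelet a" "u = rotate i a"
    and b: "asym_bracelet b" "v = rotate j b"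
    unfolding S_set_iff by blast
  obtain j' where "rotate i a = rotate j' (rev b)"
    using \<open>u = rev v\<close> a b rev_rotate_ex by metis
  then obtain m where m: "a = rotate m (rev b)"
    using rotate_eq_imp rotate_rotate by metis
  then obtain m' where "rev b = rotate m' a" using rotate_eq_imp by metis
  then obtain m'' where "b = rotate m'' (rev a)" using rev_rotate_ex rev_rev_ident by metis
  then have "lex_less a b" "lex_less b a" using a b m unfolding asym_bracelet_def by metis+
  then show False using lex_less_trans lex_less_irrefl by blast
qed

abbreviation linked :: "nat \<Rightarrow> nat \<Rightarrow> nat list \<Rightarrow> nat list \<Rightarrow> bool" where
  "linked k n u v \<equiv> (u, v) \<in> (word_link (S_set k n))\<^sup>*"

lemma linked_sym: "linked k n u v \<Longrightarrow> linked k n v u"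
proof -
  have "sym (word_link (S_set k n))" by (auto simp: word_link_def sym_def)
  then show "linked k n u v \<Longrightarrow> linked k n v u" by (meson sym_rtrancl symD)
qed

lemma linked_rotate:
  assumes "w \<in> S_set k n"
  shows "linked k n w (rotate m w)"
proof (induction m)
  case (Suc m)
  have "(rotate m w, rotate (Suc m) w) \<in> word_link (S_set k n)"
    using rotate_in_S_set[OF assms] by (auto simp: word_link_def simp del: rotate_Suc) simp
  then show ?case using Suc by (meson rtrancl.rtrancl_into_rtrancl)
qed simp

text \<open>Rotate the letter to the front, exchange it there while keeping \<open>tl\<close>, and
  rotate back.\<close>

lemma linked_letter_change:
  assumes "x @ c # y \<in> S_set k n" "x @ d # y \<in> S_set k n"
  shows "linked k n (x @ c # y) (x @ d # y)"
proof -
  have rot: "rotate (length x) (x @ e # y) = e # y @ x" for e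
    by (simp add: rotate_append)
  have "(c # y @ x, d # y @ x) \<in> word_link (S_set k n)"
    using rotate_in_S_set[OF assms(1), of "length x"] rotate_in_S_set[OF assms(2), of "length x"]
    unfolding rot by (simp add: word_link_def)
  moreover have "linked k n (x @ c # y) (c # y @ x)" "linked k n (d # y @ x) (x @ d # y)"
    using linked_rotate[OF assms(1), of "length x"]
      linked_sym[OF linked_rotate[OF assms(2), of "length x"]] unfolding rot by auto
  ultimately show ?thesis by (meson rtrancl.rtrancl_into_rtrancl rtrancl_trans)
qed

section \<open>Reduction of all words to \<open>root\<close>\<close>

context
  fixes k n M :: nat
  assumes n: "n \<ge> 3" and k: "k = Suc M" and M: "M \<ge> 2"
begin

lemma single_zero_in_S_set:
  assumes "0 \<notin> set b" "set b \<subseteq> {..M}" "Suc (length b) = n" "lex_less b (rev b)"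
  shows "0 # b \<in> S_set k n"
  using assms k by (intro asym_bracelet_in_S_set asym_bracelet_Cons_zero) auto

definition root :: "nat list" where
  "root = 0 # (M - 1) # replicate (n - 2) M"

lemma root_in_S_set: "root \<in> S_set k n"
proof -
  \<comment> \<open>The final block of \<open>M\<close> must be nonempty for the part after
    \<open>0\<close> to be smaller than its reversal.\<close>
  have "\<exists>m. n - 2 = Suc m" using n by presburger
  then obtain m where "n - 2 = Suc m" by blast
  then show ?thesis
    unfolding root_def using M n
    by (intro single_zero_in_S_set) (auto simp: replicate_app_Cons_same)
qed

text \<open>Two letter changes suffice: lower the \<open>M\<close> after \<open>0\<close> to
  \<open>M - 1\<close>, then raise the old \<open>M - 1\<close> to \<open>M\<close>. The word in
  between is admissible since its part after \<open>0\<close> starts with \<open>M - 1\<close> and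
  ends with \<open>M\<close>.\<close>

lemma linked_root_single_zero:
  assumes "g < t" "g + t + 2 = n"
  shows "linked k n (0 # replicate g M @ (M - 1) # replicate t M) root"
proof (cases g)
  case 0
  then have "n - 2 = t" using assms by simp
  then show ?thesis using 0 by (simp add: root_def)
next
  case (Suc h)
  obtain s where t: "t = Suc s" using assms by (cases t) auto
  let ?y = "replicate h M @ (M - 1) # replicate t M"
  have u: "[0] @ M # ?y \<in> S_set k n"
  proof -
    have "replicate t M = replicate g M @ M # replicate (t - g - 1) M"
      using assms by (simp flip: replicate_Suc replicate_add add: Suc_diff_Suc)
    then have "lex_less (replicate g M @ (M - 1) # replicate t M) (replicate t M @ (M - 1) # replicate g M)"
      using M by (simp add: lex_less_append_iff)
    then have "0 # replicate g M @ (M - 1) # replicate t M \<in> S_set k n"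
      using M assms by (intro single_zero_in_S_set) auto
    then show ?thesis by (simp add: Suc)
  qed
  have v: "[0] @ (M - 1) # ?y \<in> S_set k n"
    unfolding append.simps
    using M assms Suc t by (intro single_zero_in_S_set) (auto simp: replicate_app_Cons_same)
  have r: "(0 # (M - 1) # replicate h M) @ M # replicate t M = root"
    using assms Suc by (simp add: root_def flip: replicate_Suc replicate_add)
  have "linked k n ([0] @ M # ?y) ([0] @ (M - 1) # ?y)"
    by (rule linked_letter_change[OF u v])
  moreover have "linked k n ((0 # (M - 1) # replicate h M) @ (M - 1) # replicate t M)
      ((0 # (M - 1) # replicate h M) @ M # replicate t M)"
    by (rule linked_letter_change) (use v root_in_S_set r in auto)
  ultimately show ?thesis unfolding r by (auto simp: Suc intro: rtrancl_trans)
qed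

lemma linked_root_zero_first:
  assumes "asym_bracelet a" "length a = n" "set a \<subseteq> {..M}" "hd a = 0"
  shows "linked k n a root"
  using assms
\<comment> \<open>The measure is the total deficit from \<open>M\<close>; raising one letter lowers
  it.\<close>
proof (induction "\<Sum>x\<leftarrow>a. M - x" arbitrary: a rule: less_induct)
  case less
  have inS: "b \<in> S_set k n" if "asym_bracelet b" "length b = n" "set b \<subseteq> {..M}" for b
    using that k by (intro asym_bracelet_in_S_set) auto
  have raise: "linked k n (x @ c # y) root"
    if a: "a = x @ c # y" and c: "c < M" "asym_bracelet (x @ Suc c # y)" "x \<noteq> []" for x c y
  proof -
    have "linked k n (x @ Suc c # y) root"
      by (rule less.hyps) (use a c less.prems in auto)
    moreover have "linked k n (x @ c # y) (x @ Suc c # y)"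
      by (intro linked_letter_change inS) (use a c less.prems in auto)
    ultimately show ?thesis by (meson rtrancl_trans)
  qed
  have "a \<noteq> []" using less.prems n by auto
  then have "0 \<in> set a" using less.prems(4) hd_in_set by metis
  then have "\<exists>x\<in>set a. x < M" using M by force
  then obtain d c y where a: "a = d @ c # y" "c < M" "\<forall>z\<in>set y. \<not> z < M"
    using split_list_last_prop[of a "\<lambda>x. x < M"] by blast
  define t where "t = length y"
  have "y = replicate t M"
    unfolding t_def using a less.prems(3) by (intro replicate_eqI) (auto simp: le_less)
  with a have a: "a = d @ c # replicate t M" "c < M" by auto
  \<comment> \<open>Otherwise the word is \<open>0 M^(n-1)\<close>, which equals its backward
    rotation with \<open>p = 1\<close>.\<close>
  have "d \<noteq> []"
  proof
    assume "d = []"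
    then have "rev (take 1 a) @ rev (drop 1 a) = a" using a by simp
    moreover have "lex_less a (rev (take 1 a) @ rev (drop 1 a))"
      using less.prems(1) \<open>a \<noteq> []\<close> unfolding asym_bracelet_iff_drop_take[OF \<open>a \<noteq> []\<close>]
      by (metis One_nat_def Suc_leI length_greater_0_conv zero_less_one)
    ultimately show False by simp
  qed
  then have d: "d \<noteq> []" "hd d = 0" "set d \<subseteq> {..M}" using less.prems a by auto
  from asym_bracelet_raise_last[OF less.prems(1)[unfolded a(1)] d a(2)] show ?case
  proof (elim disjE exE conjE)
    assume "asym_bracelet (d @ Suc c # replicate t M)"
    then show ?thesis using raise[OF a] \<open>d \<noteq> []\<close> a(1) by simp
  next
    fix P g assume P: "P \<noteq> []" "rev P = P" "g < t" "d = P @ replicate g M" "Suc c = M"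
    \<comment> \<open>The palindrome starts with \<open>0\<close>, so it ends with \<open>0\<close>,
      and that letter is the next candidate for raising.\<close>
    have "last P = hd (rev P)" using P(1) by (simp add: hd_rev)
    then have "last P = 0" using P d by simp
    then obtain x where x: "P = x @ [0]" using P(1) by (metis append_butlast_last_id)
    have c: "c = M - 1" using P by simp
    have ax: "a = x @ 0 # replicate g M @ (M - 1) # replicate t M"
      unfolding a(1) P(4) x c by simp
    show ?thesis
    proof (cases "x = []")
      case True
      then show ?thesis
        using ax linked_root_single_zero[OF P(3)] less.prems(2) by simp
    next
      case False
      then have "hd x = 0" using ax less.prems(4) by simp
      then have "asym_bracelet (x @ Suc 0 # replicate g M @ (M - 1) # replicate t M)"
        using asym_bracelet_raise_palindrome[of x g M t] less.prems(1) False P(2,3) M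
        unfolding ax x by simp
      then show ?thesis using raise[OF ax] False M ax by simp
    qed
  qed
qed

lemma linked_root:
  assumes w: "w \<in> S_set k n"
  shows "linked k n w root"
proof -
  obtain a m where a: "asym_bracelet a" "length a = n" "set a \<subseteq> {..<k}" "w = rotate m a"
    using w unfolding S_set_iff by blast
  have aS: "a \<in> S_set k n" using a by (intro asym_bracelet_in_S_set)
  have sub: "set a \<subseteq> {..M}" using a(3) k by auto
  have "linked k n a root"
  proof (cases "0 \<in> set a")
    case True
    then obtain x y where xy: "a = x @ 0 # y" by (meson split_list)
    \<comment> \<open>A bracelet containing \<open>0\<close> starts with \<open>0\<close>, as it is
      at most its rotation starting at that letter.\<close>
    have "lex_le a (rotate (length x) a)" using a(1) unfolding asym_bracelet_def by blast
    moreover have "rotate (length x) a = 0 # y @ x" unfolding xy by (simp add: rotate_append)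
    ultimately have "hd a = 0" using xy by (cases x) (auto simp: lex_le_def)
    then show ?thesis by (intro linked_root_zero_first a sub)
  next
    case False
    have "a \<noteq> []" using a n by auto
    then obtain e b where e: "a = e # b" by (cases a) auto
    \<comment> \<open>This backward rotation keeps the first letter in front; cancelling it leaves
      \<open>b\<close> smaller than \<open>rev b\<close>, so the first letter can be replaced by
      \<open>0\<close>.\<close>
    have "lex_less a (rev (take 1 a) @ rev (drop 1 a))"
      using a(1) \<open>a \<noteq> []\<close> unfolding asym_bracelet_iff_drop_take[OF \<open>a \<noteq> []\<close>]
      by (metis One_nat_def Suc_leI length_greater_0_conv zero_less_one)
    then have "lex_less b (rev b)" using e by simp
    then have b: "asym_bracelet (0 # b)" using False e by (intro asym_bracelet_Cons_zero) auto
    then have "0 # b \<in> S_set k n" using a e k by (intro asym_bracelet_in_S_set) auto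
    then have "linked k n ([] @ e # b) ([] @ 0 # b)"
      using aS e by (intro linked_letter_change) auto
    moreover have "linked k n (0 # b) root"
      by (rule linked_root_zero_first) (use b a sub e in auto)
    ultimately show ?thesis using e by (auto intro: rtrancl_trans)
  qed
  moreover have "linked k n w a"
    unfolding a(4) using linked_sym[OF linked_rotate[OF aS]] .
  ultimately show ?thesis by (meson rtrancl_trans)
qed

end

theorem mainTheorem11:
  fixes n k :: nat
  assumes "n \<ge> 3" and "k \<ge> 3"
  shows "\<exists>s. set s \<subseteq> {..<k} \<and> length s = card (S_set k n) \<and>
             bij_betw (window s n) {..<length s} (S_set k n) \<and>
             orientable n s"
proof -
  let ?S = "S_set k n"
  define M where "M = k - 1"
  have M: "k = Suc M" "M \<ge> 2" using assms by (auto simp: M_def)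
  have len: "length w = n" and sub: "set w \<subseteq> {..<k}" if "w \<in> ?S" for w
    using that by (auto simp: S_set_iff)
  have "finite ?S"
    by (rule finite_subset[OF _ finite_lists_length_eq[of "{..<k}" n]]) (use len sub in auto)
  moreover have "?S \<noteq> {}" using root_in_S_set[OF assms(1) M] by auto
  moreover have "rotate1 w \<in> ?S" if "w \<in> ?S" for w
    using rotate_in_S_set[OF that, of 1] by (simp add: rotate_def)
  moreover have "linked k n u v" if "u \<in> ?S" "v \<in> ?S" for u v
    using linked_root[OF assms(1) M that(1)] linked_sym[OF linked_root[OF assms(1) M that(2)]]
    by (rule rtrancl_trans)
  ultimately obtain s where s: "length s = card ?S" "set s \<subseteq> \<Union>(set ` ?S)"
    and bij: "bij_betw (window s n) {..<length s} ?S"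
    using universal_cycle_exists[of ?S n] len assms(1) by auto
  have inj: "inj_on (window s n) {..<length s}" and win: "\<And>t. t < length s \<Longrightarrow> window s n t \<in> ?S"
    using bij by (auto simp: bij_betw_def)
  have "window s n t \<noteq> rev (window s n t')" if "t < length s" "t' < length s" for t t'
    using win[OF that(1)] win[OF that(2)] by (rule rev_notin_S_set)
  then have "orientable n s"
    unfolding orientable_def using inj by (auto simp: inj_on_def)
  moreover have "set s \<subseteq> {..<k}" using s(2) sub by blast
  ultimately show ?thesis using s(1) bij by blast
qed

end
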